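(* Let $S\in\mathbb{R}^{d_S}$ and $Y\in\mathbb{R}^{d_Y}$ be random vectors whose joint distribution is Gaussian, with the covariance matrix $\Sigma_Y$ of $Y$ invertible. Then the solution $S_Y=T(S,Y)$ of the optimal transport barycenter problem for $S\mid Y$ under the quadratic cost is $$S_Y=T(S,Y)=S-\Sigma_{SY}\Sigma_Y^{-1}\big(Y-\mathbb{E}[Y]\big),$$ that is, it agrees, except for the intercept, with the residual of the linear regression of $S$ against $Y$.
   Context: $\Sigma_{SY}=\mathrm{Cov}(S,Y)\in\mathbb{R}^{d_S\times d_Y}$ is the cross-covariance matrix. The (Monge) optimal transport barycenter problem for $S\mid Y$ under the quadratic cost is $$\min_{U}\ \mathbb{E}\big[\|S-U\|^2\big]\quad\text{over all random vectors of the form } U=\tilde T(S,Y)\in\mathbb{R}^{d_S},\ \tilde T \text{ measurable, such that } U \text{ is independent of } Y,$$ and $S_Y=T(S,Y)$ denotes its minimizer. *)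

theory Defs
  imports "HOL-Probability.Probability"
begin

text \<open>Degenerate Gaussians are included: a point mass is the Gaussian of standard deviation 0,
  a case not covered by \<^const>\<open>normal_density\<close>.\<close>

definition gaussian_law :: "real \<Rightarrow> real \<Rightarrow> real measure" where
  "gaussian_law m \<sigma> = (if \<sigma> = 0 then return borel m else density lborel (normal_density m \<sigma>))"

definition gaussian_vector :: "'a measure \<Rightarrow> ('a \<Rightarrow> 'b::euclidean_space) \<Rightarrow> bool" where
  "gaussian_vector M X \<longleftrightarrow>
     X \<in> borel_measurable M \<and>
     (\<forall>u. \<exists>m \<sigma>. 0 \<le> \<sigma> \<and> distr M borel (\<lambda>\<omega>. u \<bullet> X \<omega>) = gaussian_law m \<sigma>)"

definition cross_covariance ::
    "'a measure \<Rightarrow> ('a \<Rightarrow> real ^ 'm) \<Rightarrow> ('a \<Rightarrow> real ^ 'n) \<Rightarrow> real ^ 'n ^ 'm" where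
  "cross_covariance M X Z =
     (\<chi> i j. \<integral>\<omega>. (X \<omega> $ i - (\<integral>\<omega>'. X \<omega>' $ i \<partial>M)) * (Z \<omega> $ j - (\<integral>\<omega>'. Z \<omega>' $ j \<partial>M)) \<partial>M)"

abbreviation covariance_matrix :: "'a measure \<Rightarrow> ('a \<Rightarrow> real ^ 'n) \<Rightarrow> real ^ 'n ^ 'n" where
  "covariance_matrix M X \<equiv> cross_covariance M X X"

text \<open>The constant \<^const>\<open>prob_space.indep_var\<close> forces both random variables to have the same
  value type, so independence is stated through the generated events.\<close>

definition indep_rv ::
    "'a measure \<Rightarrow> ('a \<Rightarrow> 'b::topological_space) \<Rightarrow> ('a \<Rightarrow> 'c::topological_space) \<Rightarrow> bool" where
  "indep_rv M X Z \<longleftrightarrow>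
     X \<in> borel_measurable M \<and> Z \<in> borel_measurable M \<and>
     prob_space.indep_set M {X -` A \<inter> space M | A. A \<in> sets borel}
                            {Z -` B \<inter> space M | B. B \<in> sets borel}"

text \<open>Expected squared distance, valued in \<^typ>\<open>ennreal\<close> so that a random vector that is not
  square-integrable has infinite cost (the Bochner integral would give 0).\<close>

definition quadratic_cost ::
    "'a measure \<Rightarrow> ('a \<Rightarrow> 'b::real_normed_vector) \<Rightarrow> ('a \<Rightarrow> 'b) \<Rightarrow> ennreal" where
  "quadratic_cost M S U = (\<integral>\<^sup>+ \<omega>. ennreal ((norm (S \<omega> - U \<omega>))\<^sup>2) \<partial>M)"

definition barycenter_admissible ::
    "'a measure \<Rightarrow> ('a \<Rightarrow> real ^ 's) \<Rightarrow> ('a \<Rightarrow> real ^ 'y) \<Rightarrow> ('a \<Rightarrow> real ^ 's) \<Rightarrow> bool" where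
  "barycenter_admissible M S Y U \<longleftrightarrow>
     (\<exists>T \<in> borel_measurable borel. \<forall>\<omega>\<in>space M. U \<omega> = T (S \<omega>, Y \<omega>)) \<and> indep_rv M U Y"

definition barycenter_solution ::
    "'a measure \<Rightarrow> ('a \<Rightarrow> real ^ 's) \<Rightarrow> ('a \<Rightarrow> real ^ 'y) \<Rightarrow> ('a \<Rightarrow> real ^ 's) \<Rightarrow> bool" where
  "barycenter_solution M S Y U \<longleftrightarrow>
     is_arg_min (quadratic_cost M S) (barycenter_admissible M S Y) U"

definition linear_regression ::
    "'a measure \<Rightarrow> ('a \<Rightarrow> real ^ 's) \<Rightarrow> ('a \<Rightarrow> real ^ 'y) \<Rightarrow> real ^ 's \<Rightarrow> real ^ 'y ^ 's \<Rightarrow> bool" where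
  "linear_regression M S Y a B \<longleftrightarrow>
     is_arg_min (\<lambda>(a, B). quadratic_cost M S (\<lambda>\<omega>. a + B *v Y \<omega>)) (\<lambda>_. True) (a, B)"

end

theory Submission
  imports Defs
begin

text \<open>Write \<open>R = S - K (Y - E Y)\<close> with the regression matrix \<open>K\<close>, so that \<open>R\<close> and \<open>Y\<close> are uncorrelated.
  For Gaussian vectors this makes the characteristic function of \<open>(R, Y)\<close> factorize, hence \<open>R\<close> and
  \<open>Y\<close> are independent and \<open>R\<close> is admissible. If \<open>U\<close> is any admissible vector of finite cost, then
  \<open>R - U\<close> is uncorrelated with \<open>Y\<close> as well, and Pythagoras in \<open>L\<^sup>2\<close> applied to
  \<open>S - U = K (Y - E Y) + (R - U)\<close> gives
  \<open>E |S - U|\<^sup>2 = E |K (Y - E Y)|\<^sup>2 + E |R - U|\<^sup>2\<close>,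
  which is minimal exactly for \<open>U = R\<close> almost everywhere. The same decomposition, applied to
  \<open>S - (a + B Y)\<close>, shows that every optimal regression has slope \<open>K\<close>.

  The multivariate uniqueness theorem behind the independence step is obtained from the
  one-dimensional theorem of Levy by replacing the factors \<open>exp (i t X\<^sub>k)\<close> by
  indicators of \<open>X\<^sub>k\<close>, one coordinate after the other; this requires a uniqueness theorem for
  complex weights rather than for probability laws.\<close>

subsection \<open>Uniqueness of Fourier transforms\<close>

text \<open>Split \<open>w\<close> into its positive and negative parts. Frequency 0 shows that both
  have the same total mass \<open>c\<close>, so after normalization each becomes the density of a
  probability measure. The distributions of \<open>X\<close> under these two measures have the same
  characteristic function and coincide by Levy's theorem.\<close>

lemma fourier_orthogonal_real:
  fixes w X :: "'a \<Rightarrow> real"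
  assumes w: "integrable M w" and X[measurable]: "X \<in> borel_measurable M"
    and orth: "\<And>t. (\<integral>x. w x *\<^sub>R iexp (t * X x) \<partial>M) = 0"
    and A[measurable]: "A \<in> sets borel"
  shows "(\<integral>x. w x * indicator A (X x) \<partial>M) = 0"
proof -
  have [measurable]: "w \<in> borel_measurable M" using w by simp
  define p where "p x = max 0 (w x)" for x
  define n where "n x = max 0 (- w x)" for x
  have p: "integrable M p" and n: "integrable M n"
    unfolding p_def n_def using w by auto
  have [measurable]: "p \<in> borel_measurable M" "n \<in> borel_measurable M"
    using p n by auto
  have pn: "w x = p x - n x" "p x \<ge> 0" "n x \<ge> 0" for x
    by (auto simp: p_def n_def)
  have int_w: "(\<integral>x. w x \<partial>M) = 0"
    using orth[of 0] by (simp flip: of_real_def)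
  define c where "c = (\<integral>x. p x \<partial>M)"
  have c_n: "(\<integral>x. n x \<partial>M) = c"
    using int_w p n by (simp add: pn c_def)
  have c0: "c \<ge> 0" unfolding c_def by (simp add: pn)
  show ?thesis
  proof (cases "c = 0")
    \<comment> \<open>Normalization by \<open>c\<close> is impossible here, but zero mass makes both
      parts, and hence \<open>w\<close>, vanish almost everywhere.\<close>
    case True
    then have "AE x in M. p x = 0" "AE x in M. n x = 0"
      using integral_nonneg_eq_0_iff_AE[OF p] integral_nonneg_eq_0_iff_AE[OF n] c_n pn
      by (auto simp: c_def)
    then have "AE x in M. w x * indicator A (X x) = 0"
      by eventually_elim (simp add: pn)
    then show ?thesis by (simp add: integral_eq_zero_AE)
  next
    case False
    with c0 have c: "c > 0" by simp
    \<comment> \<open>The distribution of \<open>X\<close> after reweighting \<open>M\<close> by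
      \<open>q / c\<close>; it is used for the two parts of \<open>w\<close>.\<close>
    define law where "law q = distr (density M (\<lambda>x. q x / c)) borel X" for q :: "'a \<Rightarrow> real"
    have law: "real_distribution (law q)"
        "\<And>t. char (law q) t = (\<integral>x. (q x / c) *\<^sub>R iexp (t * X x) \<partial>M)"
        "measure (law q) A = (\<integral>x. q x * indicator A (X x) \<partial>M) / c"
      if q: "integrable M q" "\<And>x. q x \<ge> 0" "(\<integral>x. q x \<partial>M) = c" for q
    proof -
      have [measurable]: "q \<in> borel_measurable M" using q by auto
      have "prob_space (density M (\<lambda>x. q x / c))"
      proof
        have "emeasure (density M (\<lambda>x. q x / c)) (space (density M (\<lambda>x. q x / c)))
            = (\<integral>\<^sup>+x. ennreal (q x / c) \<partial>M)"
          by (subst emeasure_density) (auto intro!: nn_integral_cong)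
        also have "\<dots> = ennreal (\<integral>x. q x / c \<partial>M)"
          using q c by (intro nn_integral_eq_integral) auto
        also have "\<dots> = 1" using q c by simp
        finally show "emeasure (density M (\<lambda>x. q x / c)) (space (density M (\<lambda>x. q x / c))) = 1" .
      qed
      then interpret D: prob_space "density M (\<lambda>x. q x / c)" .
      show "real_distribution (law q)"
        unfolding law_def by simp
      then interpret L: real_distribution "law q" .
      show "char (law q) t = (\<integral>x. (q x / c) *\<^sub>R iexp (t * X x) \<partial>M)" for t
        unfolding char_def law_def using q c
        by (subst integral_distr, simp, simp, subst integral_density) auto
      have "measure (law q) A = (\<integral>x. indicator A x \<partial>law q)"
        by simp
      also have "\<dots> = (\<integral>x. (q x / c) * indicator A (X x) \<partial>M)"
        unfolding law_def using q c
        by (subst integral_distr, simp, simp, subst integral_density) auto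
      finally show "measure (law q) A = (\<integral>x. q x * indicator A (X x) \<partial>M) / c"
        by simp
    qed
    have iexp_int: "integrable M (\<lambda>x. (q x / c) *\<^sub>R iexp (t * X x))" if "integrable M q" for q t
    proof (rule Bochner_Integration.integrable_bound)
      show "integrable M (\<lambda>x. q x / c)" using that by simp
      have [measurable]: "q \<in> borel_measurable M" using that by simp
      show "(\<lambda>x. (q x / c) *\<^sub>R iexp (t * X x)) \<in> borel_measurable M" by measurable
    qed (simp add: norm_mult del: of_real_mult)
    have "char (law p) = char (law n)"
    proof
      fix t
      have "char (law p) t - char (law n) t
          = (\<integral>x. (p x / c) *\<^sub>R iexp (t * X x) - (n x / c) *\<^sub>R iexp (t * X x) \<partial>M)"
        using law(2)[OF p] law(2)[OF n] pn c_n iexp_int[OF p] iexp_int[OF n]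
        by (simp add: c_def)
      also have "\<dots> = (\<integral>x. (1 / c) *\<^sub>R (w x *\<^sub>R iexp (t * X x)) \<partial>M)"
        by (intro Bochner_Integration.integral_cong)
           (simp_all add: pn algebra_simps diff_divide_distrib)
      also have "\<dots> = 0" by (simp only: integral_scaleR_right orth scaleR_zero_right)
      finally show "char (law p) t = char (law n) t" by simp
    qed
    then have "law p = law n"
      using law(1)[OF p] law(1)[OF n] pn c_n by (intro Levy_uniqueness) (auto simp: c_def)
    then have eq: "(\<integral>x. p x * indicator A (X x) \<partial>M) = (\<integral>x. n x * indicator A (X x) \<partial>M)"
      using law(3)[OF p] law(3)[OF n] pn c_n c by (simp add: c_def)
    have ind: "integrable M (\<lambda>x. q x * indicator A (X x))" if "integrable M q" for q :: "'a \<Rightarrow> real"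
    proof (rule Bochner_Integration.integrable_bound[OF that])
      have [measurable]: "q \<in> borel_measurable M" using that by simp
      show "(\<lambda>x. q x * indicator A (X x)) \<in> borel_measurable M" by measurable
    qed (simp add: indicator_def)
    show ?thesis
      using eq ind[OF p] ind[OF n] by (simp add: pn left_diff_distrib)
  qed
qed

lemma integrable_mult_bounded:
  fixes W g :: "'a \<Rightarrow> complex"
  assumes "integrable M W" "g \<in> borel_measurable M" "\<And>x. norm (g x) \<le> 1"
  shows "integrable M (\<lambda>x. W x * g x)"
proof (rule Bochner_Integration.integrable_bound[OF assms(1)])
  show "AE x in M. norm (W x * g x) \<le> norm (W x)"
    using assms(3) by (simp add: norm_mult mult_left_le)
qed (use assms in measurable)

text \<open>Conjugation turns frequency \<open>t\<close> into \<open>- t\<close>, and the hypothesis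
  covers all real frequencies, so \<open>cnj W\<close> satisfies it too. Real and imaginary part of
  \<open>W\<close> are combinations of \<open>W\<close> and \<open>cnj W\<close>, and the real case
  applies to each of them.\<close>

lemma fourier_orthogonal_complex:
  fixes W :: "'a \<Rightarrow> complex" and X :: "'a \<Rightarrow> real"
  assumes W: "integrable M W" and X[measurable]: "X \<in> borel_measurable M"
    and orth: "\<And>t. (\<integral>x. W x * iexp (t * X x) \<partial>M) = 0"
    and A[measurable]: "A \<in> sets borel"
  shows "(\<integral>x. W x * indicator A (X x) \<partial>M) = 0"
proof -
  have int: "integrable M (\<lambda>x. V x * iexp (t * X x))" if "integrable M V" for V t
    using that by (intro integrable_mult_bounded) (auto simp del: of_real_mult)
  have cnj: "(\<integral>x. cnj (W x) * iexp (t * X x) \<partial>M) = 0" for t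
  proof -
    have "cnj (\<integral>x. W x * iexp ((- t) * X x) \<partial>M) = (\<integral>x. cnj (W x * iexp ((- t) * X x)) \<partial>M)"
      by (rule Bochner_Integration.integral_cnj[symmetric])
    also have "\<dots> = (\<integral>x. cnj (W x) * iexp (t * X x) \<partial>M)"
      by (intro Bochner_Integration.integral_cong) (simp_all add: exp_cnj)
    finally show ?thesis using orth[of "- t"] by simp
  qed
  have W': "integrable M (\<lambda>x. cnj (W x))" using W by simp
  have "(\<integral>x. Re (W x) *\<^sub>R iexp (t * X x) \<partial>M) = 0" for t
  proof -
    have "(\<integral>x. Re (W x) *\<^sub>R iexp (t * X x) \<partial>M)
        = (\<integral>x. (W x * iexp (t * X x) + cnj (W x) * iexp (t * X x)) * (1 / 2) \<partial>M)"
      by (intro Bochner_Integration.integral_cong refl)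
         (simp add: scaleR_conv_of_real complex_add_cnj flip: distrib_right)
    also have "\<dots> = 0"
      using int[OF W] int[OF W'] by (simp add: orth cnj del: of_real_mult)
    finally show ?thesis .
  qed
  then have re: "(\<integral>x. Re (W x) * indicator A (X x) \<partial>M) = 0"
    using W by (intro fourier_orthogonal_real) auto
  have "(\<integral>x. Im (W x) *\<^sub>R iexp (t * X x) \<partial>M) = 0" for t
  proof -
    have "(\<integral>x. Im (W x) *\<^sub>R iexp (t * X x) \<partial>M)
        = (\<integral>x. (W x * iexp (t * X x) - cnj (W x) * iexp (t * X x)) * (1 / (2 * \<i>)) \<partial>M)"
      by (intro Bochner_Integration.integral_cong refl)
         (simp add: scaleR_conv_of_real complex_diff_cnj flip: left_diff_distrib, simp add: mult_ac)
    also have "\<dots> = 0"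
      using int[OF W] int[OF W'] by (simp add: orth cnj del: of_real_mult)
    finally show ?thesis .
  qed
  then have im: "(\<integral>x. Im (W x) * indicator A (X x) \<partial>M) = 0"
    using W by (intro fourier_orthogonal_real) auto
  have ind: "(indicator A y :: complex) = complex_of_real (indicator A y)" for y
    by (simp add: indicator_def)
  have "integrable M (\<lambda>x. W x * indicator A (X x))"
    using W by (intro integrable_mult_bounded) (auto simp: indicator_def)
  then show ?thesis
    using re im unfolding ind by (intro complex_eqI) (simp_all flip: integral_Re integral_Im)
qed

text \<open>Induction on the coordinate set with \<open>W\<close> arbitrary: the indicator of the
  new coordinate is absorbed into the weight. Frequencies are given as a function \<open>u\<close>
  on coordinates so that one of them can be changed while the others stay fixed.\<close>

lemma fourier_orthogonal_coordinates:
  fixes W :: "'a \<Rightarrow> complex" and X :: "'a \<Rightarrow> 'b::euclidean_space"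
  assumes D: "finite D" "D \<subseteq> Basis"
    and W: "integrable M W" and X[measurable]: "X \<in> borel_measurable M"
    and orth: "\<And>u. (\<integral>x. W x * iexp (\<Sum>b\<in>D. u b * (X x \<bullet> b)) \<partial>M) = 0"
    and A: "\<And>b. A b \<in> sets borel"
  shows "(\<integral>x. W x * (\<Prod>b\<in>D. indicator (A b) (X x \<bullet> b)) \<partial>M) = 0"
  using D W orth
proof (induction arbitrary: W)
  case empty
  then show ?case by simp
next
  case (insert b D)
  note [measurable] = A
  have "(\<integral>x. (W x * indicator (A b) (X x \<bullet> b)) * (\<Prod>b\<in>D. indicator (A b) (X x \<bullet> b)) \<partial>M) = 0"
  proof (rule insert.IH)
    show "D \<subseteq> Basis" using insert by simp
    show "integrable M (\<lambda>x. W x * indicator (A b) (X x \<bullet> b))"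
      using insert by (intro integrable_mult_bounded) (auto simp: indicator_def)
    fix u :: "'b \<Rightarrow> real"
    \<comment> \<open>With the frequencies on \<open>D\<close> frozen, their exponential becomes
      part of a complex weight. Varying only the frequency of \<open>b\<close>, via
      \<open>u(b := t)\<close>, leaves the sum over \<open>D\<close> unchanged because
      \<open>b\<close> lies outside \<open>D\<close>, so the one-dimensional theorem
      applies.\<close>
    have "(\<integral>x. (W x * iexp (\<Sum>b\<in>D. u b * (X x \<bullet> b))) * indicator (A b) (X x \<bullet> b) \<partial>M) = 0"
    proof (rule fourier_orthogonal_complex)
      show "integrable M (\<lambda>x. W x * iexp (\<Sum>b\<in>D. u b * (X x \<bullet> b)))"
        using insert by (intro integrable_mult_bounded) (auto simp del: of_real_sum)
      fix t :: real
      have "(\<Sum>c\<in>D. (u(b := t)) c * (X x \<bullet> c)) = (\<Sum>c\<in>D. u c * (X x \<bullet> c))" for x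
        using insert.hyps by (intro sum.cong) auto
      then have "(\<Sum>c\<in>insert b D. (u(b := t)) c * (X x \<bullet> c)) = (\<Sum>c\<in>D. u c * (X x \<bullet> c)) + t * (X x \<bullet> b)" for x
        using insert.hyps by simp
      then show "(\<integral>x. W x * iexp (\<Sum>b\<in>D. u b * (X x \<bullet> b)) * iexp (t * (X x \<bullet> b)) \<partial>M) = 0"
        using insert.prems(3)[of "u(b := t)"] by (simp only: mult.assoc of_real_add distrib_left exp_add)
    qed (auto intro: A)
    then show "(\<integral>x. W x * indicator (A b) (X x \<bullet> b) * iexp (\<Sum>b\<in>D. u b * (X x \<bullet> b)) \<partial>M) = 0"
      by (simp only: mult_ac)
  qed
  then show ?case using insert.hyps by (simp add: mult.assoc)
qed

text \<open>The indicator of a box is a product of indicators of coordinate intervals, which settles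
  boxes. They form an intersection-stable generator of the Borel sets. The sets with vanishing
  integral are closed under complements, since frequency 0 gives total integral zero, and under
  countable disjoint unions.\<close>

lemma fourier_orthogonal:
  fixes W :: "'a \<Rightarrow> complex" and X :: "'a \<Rightarrow> 'b::euclidean_space"
  assumes W: "integrable M W" and X[measurable]: "X \<in> borel_measurable M"
    and orth: "\<And>u. (\<integral>x. W x * iexp (u \<bullet> X x) \<partial>M) = 0"
    and A: "A \<in> sets borel"
  shows "(\<integral>x. W x * indicator A (X x) \<partial>M) = 0"
proof -
  let ?G = "range (\<lambda>(a, b). box a b) :: 'b set set"
  have sets_eq: "sets borel = sigma_sets UNIV ?G"
    by (subst borel_eq_box) simp
  have int: "integrable M (\<lambda>x. W x * indicator A (X x))" if "A \<in> sets borel" for A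
    using that W by (intro integrable_mult_bounded) (auto simp: indicator_def)
  have box: "(\<integral>x. W x * indicator (box a b) (X x) \<partial>M) = 0" for a b
  proof -
    have "(\<integral>x. W x * (\<Prod>c\<in>Basis. indicator {a \<bullet> c <..< b \<bullet> c} (X x \<bullet> c)) \<partial>M) = 0"
    proof (rule fourier_orthogonal_coordinates)
      fix u :: "'b \<Rightarrow> real"
      have "(\<Sum>b\<in>Basis. u b *\<^sub>R b) \<bullet> X x = (\<Sum>b\<in>Basis. u b * (X x \<bullet> b))" for x
        by (simp add: inner_sum_left inner_commute[of "X x"])
      then show "(\<integral>x. W x * iexp (\<Sum>b\<in>Basis. u b * (X x \<bullet> b)) \<partial>M) = 0"
        using orth[of "\<Sum>b\<in>Basis. u b *\<^sub>R b"] by (simp only:)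
    qed (use W in auto)
    moreover have "(\<Prod>c\<in>Basis. indicator {a \<bullet> c <..< b \<bullet> c} (X x \<bullet> c)) = (indicator (box a b) (X x) :: complex)" for x
      by (auto simp: indicator_def box_def)
    ultimately show ?thesis by simp
  qed
  have all: "(\<integral>x. W x \<partial>M) = 0"
    using orth[of 0] by simp
  have "Int_stable ?G"
    by (auto simp: Int_stable_def box_Int_box intro: image_eqI[of _ _ "(_, _)"])
  moreover have "?G \<subseteq> Pow UNIV" by simp
  moreover have "A \<in> sigma_sets UNIV ?G" using A sets_eq by simp
  ultimately show ?thesis
  proof (induction rule: sigma_sets_induct_disjoint)
    case (basic A)
    then show ?case using box by auto
  next
    case empty
    then show ?case by simp
  next
    case (compl A)
    then have "A \<in> sets borel" by (simp add: sets_eq)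
    have "(\<integral>x. W x * indicator (UNIV - A) (X x) \<partial>M) = (\<integral>x. W x - W x * indicator A (X x) \<partial>M)"
      by (intro Bochner_Integration.integral_cong) (auto simp: indicator_def)
    then show ?case
      using compl W int[OF \<open>A \<in> sets borel\<close>] all by simp
  next
    case (union A)
    then have [measurable]: "A i \<in> sets borel" for i by (auto simp: sets_eq)
    have "(\<lambda>i. \<integral>x. W x * indicator (A i) (X x) \<partial>M) sums (\<integral>x. W x * indicator (\<Union>i. A i) (X x) \<partial>M)"
    proof -
      \<comment> \<open>The integrable function \<open>norm (W x)\<close> dominates all integrands
        over finite unions; disjointness then turns those integrals into the partial sums of the
        series.\<close>
      have "(\<lambda>n. \<integral>x. W x * indicator (\<Union>i<n. A i) (X x) \<partial>M) \<longlonglongrightarrow> (\<integral>x. W x * indicator (\<Union>i. A i) (X x) \<partial>M)"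
      proof (rule integral_dominated_convergence[where w="\<lambda>x. norm (W x)"])
        show "AE x in M. (\<lambda>n. W x * indicator (\<Union>i<n. A i) (X x)) \<longlonglongrightarrow> W x * indicator (\<Union>i. A i) (X x)"
          by (intro AE_I2 tendsto_intros LIMSEQ_indicator_UN)
      qed (use W in \<open>auto simp: indicator_def\<close>)
      moreover have "(\<integral>x. W x * indicator (\<Union>i<n. A i) (X x) \<partial>M) = (\<Sum>i<n. \<integral>x. W x * indicator (A i) (X x) \<partial>M)" for n
      proof -
        have "disjoint_family_on A {..<n}"
          using union by (auto simp: disjoint_family_on_def)
        then have "indicator (\<Union>i<n. A i) (X x) = (\<Sum>i<n. indicator (A i) (X x) :: complex)" for x
          by (simp add: indicator_UN_disjoint)
        then show ?thesis
          using int by (simp only: sum_distrib_left, intro Bochner_Integration.integral_sum) auto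
      qed
      ultimately show ?thesis by (simp add: sums_def)
    qed
    then show ?case
      using union by (simp add: sums_iff)
  qed
qed

subsection \<open>Independence\<close>

lemma (in prob_space) indep_rv_eq:
  assumes [measurable]: "X \<in> borel_measurable M" "Z \<in> borel_measurable M"
  shows "indep_rv M X Z \<longleftrightarrow>
    (\<forall>A\<in>sets borel. \<forall>B\<in>sets borel. prob {x\<in>space M. X x \<in> A \<and> Z x \<in> B}
       = prob {x\<in>space M. X x \<in> A} * prob {x\<in>space M. Z x \<in> B})"
proof -
  have 1: "X -` A \<inter> space M = {x\<in>space M. X x \<in> A}" for A by auto
  have 2: "Z -` A \<inter> space M = {x\<in>space M. Z x \<in> A}" for A by auto
  have 3: "{x\<in>space M. X x \<in> A} \<inter> {x\<in>space M. Z x \<in> B} = {x\<in>space M. X x \<in> A \<and> Z x \<in> B}" for A B by auto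
  show ?thesis
    unfolding indep_rv_def indep_sets2_eq 1 2 by (simp add: Setcompr_eq_image image_subset_iff 3)
qed

text \<open>Kac's criterion. Uniqueness is applied twice: first with the centred weight
  \<open>exp (i u \<bullet> X) - E (exp (i u \<bullet> X))\<close>, then with the centred indicator of an event of \<open>Z\<close>.\<close>

lemma (in prob_space) indep_rv_if_char_factorizes:
  fixes X :: "'a \<Rightarrow> 'b::euclidean_space" and Z :: "'a \<Rightarrow> 'c::euclidean_space"
  assumes X[measurable]: "X \<in> borel_measurable M" and Z[measurable]: "Z \<in> borel_measurable M"
    and factor: "\<And>u v. (\<integral>x. iexp (u \<bullet> X x + v \<bullet> Z x) \<partial>M)
                  = (\<integral>x. iexp (u \<bullet> X x) \<partial>M) * (\<integral>x. iexp (v \<bullet> Z x) \<partial>M)"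
  shows "indep_rv M X Z"
proof -
  have int: "integrable M (\<lambda>x. g x)" if "g \<in> borel_measurable M" "\<And>x. norm (g x) \<le> 1" for g :: "'a \<Rightarrow> complex"
    using that by (intro integrable_const_bound[of _ 1]) auto
  have 1: "(\<integral>x. iexp (u \<bullet> X x) * indicator B (Z x) \<partial>M)
      = (\<integral>x. iexp (u \<bullet> X x) \<partial>M) * (\<integral>x. indicator B (Z x) \<partial>M)" if [measurable]: "B \<in> sets borel" for u B
  proof -
    define c where "c = (\<integral>x. iexp (u \<bullet> X x) \<partial>M)"
    have "(\<integral>x. (iexp (u \<bullet> X x) - c) * indicator B (Z x) \<partial>M) = 0"
    proof (rule fourier_orthogonal)
      show "integrable M (\<lambda>x. iexp (u \<bullet> X x) - c)"
        by (intro Bochner_Integration.integrable_diff int integrable_const) auto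
      fix v
      have "(\<integral>x. (iexp (u \<bullet> X x) - c) * iexp (v \<bullet> Z x) \<partial>M)
          = (\<integral>x. iexp (u \<bullet> X x + v \<bullet> Z x) - c * iexp (v \<bullet> Z x) \<partial>M)"
        by (intro Bochner_Integration.integral_cong refl)
           (simp add: left_diff_distrib distrib_left exp_add)
      also have "\<dots> = (\<integral>x. iexp (u \<bullet> X x + v \<bullet> Z x) \<partial>M) - (\<integral>x. c * iexp (v \<bullet> Z x) \<partial>M)"
        by (intro Bochner_Integration.integral_diff int integrable_mult_right)
           (auto simp del: of_real_add)
      also have "\<dots> = 0" by (simp add: factor c_def del: of_real_add)
      finally show "(\<integral>x. (iexp (u \<bullet> X x) - c) * iexp (v \<bullet> Z x) \<partial>M) = 0" .
    qed fact+
    also have "(\<integral>x. (iexp (u \<bullet> X x) - c) * indicator B (Z x) \<partial>M)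
        = (\<integral>x. iexp (u \<bullet> X x) * indicator B (Z x) - c * indicator B (Z x) \<partial>M)"
      by (simp add: left_diff_distrib)
    also have "\<dots> = (\<integral>x. iexp (u \<bullet> X x) * indicator B (Z x) \<partial>M) - (\<integral>x. c * indicator B (Z x) \<partial>M)"
      by (intro Bochner_Integration.integral_diff int integrable_mult_right)
         (auto simp: norm_mult indicator_def)
    finally show ?thesis by (simp add: c_def)
  qed
  have 2: "(\<integral>x. indicator B (Z x) * indicator A (X x) \<partial>M)
      = (\<integral>x. indicator B (Z x) \<partial>M) * (\<integral>x. (indicator A (X x) :: complex) \<partial>M)"
    if [measurable]: "A \<in> sets borel" "B \<in> sets borel" for A B
  proof -
    define c where "c = (\<integral>x. (indicator B (Z x) :: complex) \<partial>M)"
    have "(\<integral>x. (indicator B (Z x) - c) * indicator A (X x) \<partial>M) = 0"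
    proof (rule fourier_orthogonal)
      show "integrable M (\<lambda>x. indicator B (Z x) - c)"
        by (intro Bochner_Integration.integrable_diff int integrable_const) (auto simp: indicator_def)
      fix u
      have "(\<integral>x. (indicator B (Z x) - c) * iexp (u \<bullet> X x) \<partial>M)
          = (\<integral>x. iexp (u \<bullet> X x) * indicator B (Z x) - c * iexp (u \<bullet> X x) \<partial>M)"
        by (simp add: left_diff_distrib mult.commute)
      also have "\<dots> = (\<integral>x. iexp (u \<bullet> X x) * indicator B (Z x) \<partial>M) - (\<integral>x. c * iexp (u \<bullet> X x) \<partial>M)"
        by (intro Bochner_Integration.integral_diff int integrable_mult_right)
           (auto simp: norm_mult indicator_def)
      also have "\<dots> = 0" by (simp add: 1 c_def)
      finally show "(\<integral>x. (indicator B (Z x) - c) * iexp (u \<bullet> X x) \<partial>M) = 0" .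
    qed fact+
    also have "(\<integral>x. (indicator B (Z x) - c) * indicator A (X x) \<partial>M)
        = (\<integral>x. indicator B (Z x) * indicator A (X x) - c * indicator A (X x) \<partial>M)"
      by (simp add: left_diff_distrib)
    also have "\<dots> = (\<integral>x. indicator B (Z x) * indicator A (X x) \<partial>M) - (\<integral>x. c * indicator A (X x) \<partial>M)"
      by (intro Bochner_Integration.integral_diff int integrable_mult_right)
         (auto simp: norm_mult indicator_def)
    finally show ?thesis by (simp add: c_def)
  qed
  \<comment> \<open>Translates the complex integrals back into real probabilities;
    \<open>of_bool\<close> is the shape that unfolding \<open>indicator\<close> produces.\<close>
  have prob_eq: "(\<integral>x. of_bool (P x) \<partial>M) = complex_of_real (prob {x\<in>space M. P x})"
    if "Measurable.pred M P" for P
  proof -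
    have "(\<integral>x. of_bool (P x) \<partial>M) = (\<integral>x. complex_of_real (indicator {x\<in>space M. P x} x) \<partial>M)"
      by (intro Bochner_Integration.integral_cong) (auto simp: indicator_def)
    also have "\<dots> = complex_of_real (prob {x\<in>space M. P x})"
    proof -
      have "{x\<in>space M. P x} \<inter> space M = {x\<in>space M. P x}" by auto
      then show ?thesis by (subst integral_complex_of_real) simp
    qed
    finally show ?thesis .
  qed
  show ?thesis
  proof (subst indep_rv_eq[OF X Z], intro ballI)
    fix A :: "'b set" and B :: "'c set"
    assume [measurable]: "A \<in> sets borel" "B \<in> sets borel"
    have "complex_of_real (prob {x\<in>space M. X x \<in> A \<and> Z x \<in> B})
        = (\<integral>x. indicator B (Z x) * indicator A (X x) \<partial>M)"
      by (subst prob_eq[symmetric]) (auto simp: indicator_def intro!: Bochner_Integration.integral_cong)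
    also have "\<dots> = complex_of_real (prob {x\<in>space M. Z x \<in> B}) * complex_of_real (prob {x\<in>space M. X x \<in> A})"
      by (subst 2) (simp_all add: indicator_def prob_eq)
    also have "\<dots> = complex_of_real (prob {x\<in>space M. X x \<in> A} * prob {x\<in>space M. Z x \<in> B})"
      by simp
    finally show "prob {x\<in>space M. X x \<in> A \<and> Z x \<in> B}
        = prob {x\<in>space M. X x \<in> A} * prob {x\<in>space M. Z x \<in> B}"
      by (simp only: of_real_eq_iff)
  qed
qed

text \<open>Single coordinates are both real-valued, so \<open>indep_var\<close> and its product
  rule become available. Since \<open>indep_var_eq\<close> speaks of generated sigma-algebras, the
  families of preimages must be shown intersection-stable before independence extends to what they
  generate.\<close>

lemma (in prob_space) indep_rv_integral_mult:
  fixes X :: "'a \<Rightarrow> real ^ 'm" and Z :: "'a \<Rightarrow> real ^ 'n"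
  assumes ind: "indep_rv M X Z" and "integrable M (\<lambda>x. X x $ i)" "integrable M (\<lambda>x. Z x $ j)"
  shows "(\<integral>x. X x $ i * Z x $ j \<partial>M) = (\<integral>x. X x $ i \<partial>M) * (\<integral>x. Z x $ j \<partial>M)"
proof (rule indep_var_lebesgue_integral)
  have [measurable]: "X \<in> borel_measurable M" "Z \<in> borel_measurable M"
    using ind by (auto simp: indep_rv_def)
  have m: "(\<lambda>x. X x $ i) \<in> borel_measurable M" "(\<lambda>x. Z x $ j) \<in> borel_measurable M"
    by (intro measurable_compose[OF _ borel_measurable_nth]; measurable)+
  have ind': "indep_rv M (\<lambda>x. X x $ i) (\<lambda>x. Z x $ j)"
    unfolding indep_rv_eq[OF m]
  proof (intro ballI)
    fix A B :: "real set" assume [measurable]: "A \<in> sets borel" "B \<in> sets borel"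
    have "{v. v $ i \<in> A} \<in> sets (borel :: (real^'m) measure)" "{v. v $ j \<in> B} \<in> sets (borel :: (real^'n) measure)"
      using measurable_sets[OF borel_measurable_nth \<open>A \<in> sets borel\<close>] measurable_sets[OF borel_measurable_nth \<open>B \<in> sets borel\<close>]
      by (simp_all add: vimage_def)
    from ind[unfolded indep_rv_eq[OF \<open>X \<in> borel_measurable M\<close> \<open>Z \<in> borel_measurable M\<close>], rule_format, OF this]
    show "prob {x \<in> space M. X x $ i \<in> A \<and> Z x $ j \<in> B} = prob {x \<in> space M. X x $ i \<in> A} * prob {x \<in> space M. Z x $ j \<in> B}"
      by simp
  qed
  show "indep_var borel (\<lambda>x. X x $ i) borel (\<lambda>x. Z x $ j)"
    unfolding indep_var_eq
  proof (intro conjI indep_set_sigma_sets)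
    show "indep_set {(\<lambda>x. X x $ i) -` A \<inter> space M |A. A \<in> sets borel}
       {(\<lambda>x. Z x $ j) -` A \<inter> space M |A. A \<in> sets borel}"
      using ind' by (simp add: indep_rv_def)
    have "Int_stable {f -` A \<inter> space M |A. A \<in> sets borel}" for f :: "'a \<Rightarrow> real"
      unfolding Int_stable_def
    proof safe
      fix A B :: "real set" assume "A \<in> sets borel" "B \<in> sets borel"
      then show "\<exists>C. f -` A \<inter> space M \<inter> (f -` B \<inter> space M) = f -` C \<inter> space M \<and> C \<in> sets borel"
        by (intro exI[of _ "A \<inter> B"]) auto
    qed
    then show "Int_stable {(\<lambda>x. X x $ i) -` A \<inter> space M |A. A \<in> sets borel}"
       "Int_stable {(\<lambda>x. Z x $ j) -` A \<inter> space M |A. A \<in> sets borel}" by this+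
  qed (use m in auto)
qed fact+

subsection \<open>Square-integrable random vectors\<close>

text \<open>Measurability of \<open>f\<close> is a separate conjunct because integrability of the
  squared norm would give it only for that scalar function.\<close>

definition sq_integrable :: "'a measure \<Rightarrow> ('a \<Rightarrow> 'b::euclidean_space) \<Rightarrow> bool" where
  "sq_integrable M f \<longleftrightarrow> f \<in> borel_measurable M \<and> integrable M (\<lambda>x. (norm (f x))\<^sup>2)"

lemma sq_integrable_measurable [measurable_dest]:
  "sq_integrable M f \<Longrightarrow> f \<in> borel_measurable M"
  by (simp add: sq_integrable_def)

lemma sq_integrable_bound:
  assumes f: "sq_integrable M f" and [measurable]: "g \<in> borel_measurable M"
    and le: "\<And>x. norm (g x) \<le> c * norm (f x)"
  shows "sq_integrable M g"
  unfolding sq_integrable_def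
proof
  have [measurable]: "f \<in> borel_measurable M" using f by measurable
  show "integrable M (\<lambda>x. (norm (g x))\<^sup>2)"
  proof (rule Bochner_Integration.integrable_bound)
    show "integrable M (\<lambda>x. c\<^sup>2 * (norm (f x))\<^sup>2)" using f by (simp add: sq_integrable_def)
    show "AE x in M. norm ((norm (g x))\<^sup>2) \<le> norm (c\<^sup>2 * (norm (f x))\<^sup>2)"
      using power_mono[OF le norm_ge_zero, of _ 2] by (simp add: power_mult_distrib)
  qed measurable
qed fact

lemma sq_integrable_linear:
  assumes "sq_integrable M f" "bounded_linear L"
  shows "sq_integrable M (\<lambda>x. L (f x))"
proof -
  interpret bounded_linear L by fact
  obtain K where K: "\<And>x. norm (L x) \<le> norm x * K" using bounded by auto
  show ?thesis
  proof (rule sq_integrable_bound[OF assms(1)])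
    show "(\<lambda>x. L (f x)) \<in> borel_measurable M"
      using assms by (intro borel_measurable_continuous_on[of L] linear_continuous_on) auto
    show "norm (L (f x)) \<le> K * norm (f x)" for x
      using K by (simp add: mult.commute)
  qed
qed

lemma sq_integrable_inner:
  assumes f: "sq_integrable M f" and g: "sq_integrable M g"
  shows "integrable M (\<lambda>x. f x \<bullet> g x)"
proof (rule Bochner_Integration.integrable_bound)
  show "integrable M (\<lambda>x. (norm (f x))\<^sup>2 + (norm (g x))\<^sup>2)"
    using f g by (simp add: sq_integrable_def)
  have [measurable]: "f \<in> borel_measurable M" "g \<in> borel_measurable M" using f g by measurable
  show "(\<lambda>x. f x \<bullet> g x) \<in> borel_measurable M" by measurable
  have "\<bar>a \<bullet> b\<bar> \<le> (norm a)\<^sup>2 + (norm b)\<^sup>2" for a b :: 'b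
  proof -
    have "2 * (norm a * norm b) \<le> (norm a)\<^sup>2 + (norm b)\<^sup>2"
      using sum_squares_bound[of "norm a" "norm b"] by simp
    moreover have "\<bar>a \<bullet> b\<bar> \<le> norm a * norm b" by (rule Cauchy_Schwarz_ineq2)
    ultimately show ?thesis
      using mult_nonneg_nonneg[of "norm a" "norm b"] by simp
  qed
  then show "AE x in M. norm (f x \<bullet> g x) \<le> norm ((norm (f x))\<^sup>2 + (norm (g x))\<^sup>2)"
    by simp
qed

lemma norm_add_squared: "(norm (a + b))\<^sup>2 = (norm a)\<^sup>2 + 2 * (a \<bullet> b) + (norm b)\<^sup>2"
  for a b :: "'b::real_inner"
  by (simp add: power2_norm_eq_inner inner_add_left inner_add_right inner_commute)

lemma sq_integrable_add:
  assumes f: "sq_integrable M f" and g: "sq_integrable M g"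
  shows "sq_integrable M (\<lambda>x. f x + g x)"
  using assms sq_integrable_inner[OF f g]
  by (auto simp: sq_integrable_def norm_add_squared)

lemma sq_integrable_diff:
  assumes f: "sq_integrable M f" and g: "sq_integrable M g"
  shows "sq_integrable M (\<lambda>x. f x - g x)"
  using sq_integrable_add[OF f sq_integrable_linear[OF g bounded_linear_minus[OF bounded_linear_ident]]]
  by simp

lemma (in finite_measure) sq_integrable_const: "sq_integrable M (\<lambda>x. c)"
  by (simp add: sq_integrable_def)

lemma sq_integrable_vec_nth:
  fixes f :: "'a \<Rightarrow> real ^ 'n"
  shows "sq_integrable M f \<Longrightarrow> sq_integrable M (\<lambda>x. f x $ i)"
  by (rule sq_integrable_linear[OF _ bounded_linear_vec_nth])

lemma sq_integrable_matrix:
  fixes f :: "'a \<Rightarrow> real ^ 'n" and B :: "real ^ 'n ^ 'm"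
  shows "sq_integrable M f \<Longrightarrow> sq_integrable M (\<lambda>x. B *v f x)"
  by (rule sq_integrable_linear[OF _ matrix_vector_mul_bounded_linear])

lemma sq_integrable_mult:
  fixes f g :: "'a \<Rightarrow> real"
  shows "sq_integrable M f \<Longrightarrow> sq_integrable M g \<Longrightarrow> integrable M (\<lambda>x. f x * g x)"
  using sq_integrable_inner[of M f g] by simp

lemma (in finite_measure) sq_integrable_integrable:
  assumes f: "sq_integrable M f"
  shows "integrable M f"
proof -
  have "integrable M (\<lambda>x. norm (f x))"
    using f by (auto simp: sq_integrable_def intro!: square_integrable_imp_integrable[of "\<lambda>x. norm (f x)"])
  then show ?thesis
    using f by (simp add: sq_integrable_def integrable_norm_iff)
qed

text \<open>The Gaussian hypothesis controls scalar projections; this assembles coordinates into a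
  vector, whose squared norm is the finite sum of their squares.\<close>

lemma sq_integrable_vec_iff:
  fixes f :: "'a \<Rightarrow> real ^ 'n"
  shows "sq_integrable M f \<longleftrightarrow> (\<forall>i. sq_integrable M (\<lambda>x. f x $ i))"
proof
  assume R: "\<forall>i. sq_integrable M (\<lambda>x. f x $ i)"
  have "f \<in> borel_measurable M"
    using R by (subst borel_measurable_euclidean_space) (auto simp: Basis_vec_def inner_axis sq_integrable_def)
  moreover have "(norm (f x))\<^sup>2 = (\<Sum>i\<in>UNIV. (norm (f x $ i))\<^sup>2)" for x
    by (simp add: norm_vec_def L2_set_def sum_nonneg)
  ultimately show "sq_integrable M f"
    using R by (simp add: sq_integrable_def)
qed (simp add: sq_integrable_vec_nth)

text \<open>Pythagoras in L2. It serves for splitting costs, for adding variances of uncorrelated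
  projections and for separating the intercept error in the regression.\<close>

lemma integral_norm_squared_orthogonal:
  assumes f: "sq_integrable M f" and g: "sq_integrable M g"
    and "(\<integral>x. f x \<bullet> g x \<partial>M) = 0"
  shows "(\<integral>x. (norm (f x + g x))\<^sup>2 \<partial>M) = (\<integral>x. (norm (f x))\<^sup>2 \<partial>M) + (\<integral>x. (norm (g x))\<^sup>2 \<partial>M)"
  using assms sq_integrable_inner[OF f g]
  by (simp add: norm_add_squared sq_integrable_def)

text \<open>The hypothesis is an upper bound because minimality delivers an inequality;
  nonnegativity of the integrand supplies the other half.\<close>

lemma integral_norm_squared_eq_0:
  assumes "sq_integrable M f" "(\<integral>x. (norm (f x))\<^sup>2 \<partial>M) \<le> 0"
  shows "AE x in M. f x = 0"
proof -
  have "(\<integral>x. (norm (f x))\<^sup>2 \<partial>M) = 0"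
    using assms by (intro antisym) simp_all
  then have "AE x in M. (norm (f x))\<^sup>2 = 0"
    using assms by (subst (asm) integral_nonneg_eq_0_iff_AE) (auto simp: sq_integrable_def)
  then show ?thesis by simp
qed

lemma quadratic_cost_eq:
  assumes "sq_integrable M (\<lambda>x. S x - U x)"
  shows "quadratic_cost M S U = ennreal (\<integral>x. (norm (S x - U x))\<^sup>2 \<partial>M)"
  unfolding quadratic_cost_def
  using assms by (intro nn_integral_eq_integral) (auto simp: sq_integrable_def)

lemma quadratic_cost_finite:
  assumes "S \<in> borel_measurable M" "U \<in> borel_measurable M" "quadratic_cost M S U < \<infinity>"
  shows "sq_integrable M (\<lambda>x. S x - U x)"
  using assms unfolding quadratic_cost_def sq_integrable_def
  by (auto intro!: integrableI_nonneg)

text \<open>Raw product moments without centring. They are covariances as soon as \<open>W\<close>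
  has mean zero, which holds for the vector \<open>centered\<close> to which the notion is applied
  below.\<close>

definition uncorrelated :: "'a measure \<Rightarrow> ('a \<Rightarrow> real ^ 'n) \<Rightarrow> ('a \<Rightarrow> real ^ 'm) \<Rightarrow> bool" where
  "uncorrelated M W V \<longleftrightarrow> (\<forall>i j. (\<integral>x. W x $ j * V x $ i \<partial>M) = 0)"

text \<open>Supplies the orthogonality that Pythagoras asks for: the inner product is a finite
  linear combination of the products \<open>W x $ j * V x $ i\<close>.\<close>

lemma uncorrelated_matrix:
  fixes W :: "'a \<Rightarrow> real ^ 'n" and V :: "'a \<Rightarrow> real ^ 'm"
  assumes W: "sq_integrable M W" and V: "sq_integrable M V" and un: "uncorrelated M W V"
  shows "(\<integral>x. (B *v W x) \<bullet> V x \<partial>M) = 0"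
proof -
  have int: "integrable M (\<lambda>x. W x $ j * V x $ i)" for i j
    by (intro sq_integrable_mult sq_integrable_vec_nth W V)
  have "(B *v W x) \<bullet> V x = (\<Sum>i\<in>UNIV. \<Sum>j\<in>UNIV. B $ i $ j * (W x $ j * V x $ i))" for x
    by (simp add: inner_vec_def matrix_vector_mult_def sum_distrib_right mult.assoc)
  then show ?thesis
    using int un by (simp add: uncorrelated_def)
qed

lemma uncorrelated_diff:
  fixes W :: "'a \<Rightarrow> real ^ 'n" and V V' :: "'a \<Rightarrow> real ^ 'm"
  assumes W: "sq_integrable M W" and V: "sq_integrable M V" "sq_integrable M V'"
    and un: "uncorrelated M W V" "uncorrelated M W V'"
  shows "uncorrelated M W (\<lambda>x. V x - V' x)"
proof -
  have "integrable M (\<lambda>x. W x $ j * V x $ i)" "integrable M (\<lambda>x. W x $ j * V' x $ i)" for i j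
    by (intro sq_integrable_mult sq_integrable_vec_nth W V)+
  then show ?thesis using un by (simp add: uncorrelated_def right_diff_distrib)
qed

lemma uncorrelated_const:
  fixes W :: "'a \<Rightarrow> real ^ 'n"
  assumes "\<And>j. (\<integral>x. W x $ j \<partial>M) = 0"
  shows "uncorrelated M W (\<lambda>x. c)"
  using assms by (simp add: uncorrelated_def)

subsection \<open>Gaussian vectors\<close>

text \<open>The characteristic function is expressed through mean and variance of \<open>X\<close>
  instead of \<open>m\<close> and \<sigma>, so that later only first and second moments have to be
  compared. The nondegenerate case is reduced to the standard normal law.\<close>

lemma (in prob_space) gaussian_law_char:
  assumes X[measurable]: "X \<in> borel_measurable M"
    and law: "distr M borel X = gaussian_law m \<sigma>" and \<sigma>: "0 \<le> \<sigma>"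
  shows "sq_integrable M X"
    and "(\<integral>x. iexp (X x) \<partial>M) = exp (\<i> * complex_of_real (\<integral>x. X x \<partial>M) - complex_of_real (variance X / 2))"
proof -
  have "sq_integrable M X \<and> (\<integral>x. iexp (X x) \<partial>M) = exp (\<i> * complex_of_real (\<integral>x. X x \<partial>M) - complex_of_real (variance X / 2))"
  proof (cases "\<sigma> = 0")
    \<comment> \<open>For a point mass \<open>X\<close> equals \<open>m\<close> almost everywhere:
      the variance is 0 and both sides are \<open>iexp m\<close>.\<close>
    case True
    have "AE y in distr M borel X. y = m"
      unfolding law gaussian_law_def True by (simp add: AE_return)
    then have ae: "AE x in M. X x = m"
      by (subst (asm) AE_distr_iff) auto
    have "integrable M (\<lambda>x. (X x)\<^sup>2) \<longleftrightarrow> integrable M (\<lambda>x. m\<^sup>2)"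
      using ae by (intro integrable_cong_AE) auto
    moreover have "(\<integral>x. X x \<partial>M) = (\<integral>x. m \<partial>M)"
      using ae by (intro integral_cong_AE) auto
    moreover have "(\<integral>x. iexp (X x) \<partial>M) = (\<integral>x. iexp m \<partial>M)"
      using ae by (intro integral_cong_AE) auto
    moreover have "(\<integral>x. (X x - m)\<^sup>2 \<partial>M) = (\<integral>x. 0 \<partial>M)"
      using ae by (intro integral_cong_AE) auto
    ultimately show ?thesis
      by (simp add: sq_integrable_def prob_space)
  next
    case False
    with \<sigma> have pos: "0 < \<sigma>" by simp
    have D: "distributed M lborel X (normal_density m \<sigma>)"
      using law False by (simp add: distributed_def gaussian_law_def cong: distr_cong)
    define N where "N x = (X x - m) / \<sigma>" for x
    have DN: "distributed M lborel N std_normal_density"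
      using D normal_standard_normal_convert[OF pos] by (simp add: N_def[abs_def])
    have [measurable]: "N \<in> borel_measurable M" unfolding N_def[abs_def] by measurable
    have X_N: "X x = m + \<sigma> * N x" for x using pos by (simp add: N_def)
    have "integrable M (\<lambda>x. (N x)\<^sup>2)"
      using distributed_integrable[OF DN, of "\<lambda>x. x\<^sup>2"] integrable_std_normal_moment[of 2] by simp
    then have "sq_integrable M N"
      by (simp add: sq_integrable_def)
    then have "sq_integrable M (\<lambda>x. m + \<sigma> * N x)"
      by (intro sq_integrable_add sq_integrable_const sq_integrable_linear[OF _ bounded_linear_mult_right])
    then have sq: "sq_integrable M X" by (simp add: X_N[abs_def])
    have lawN: "distr M borel N = std_normal_distribution"
      using DN by (simp add: distributed_def cong: distr_cong)
    have "(\<integral>x. iexp (X x) \<partial>M) = (\<integral>x. iexp m * iexp (\<sigma> * N x) \<partial>M)"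
      by (simp add: X_N distrib_left exp_add)
    also have "\<dots> = iexp m * (\<integral>x. iexp (\<sigma> * N x) \<partial>M)"
      by (rule integral_mult_right_zero)
    also have "(\<integral>x. iexp (\<sigma> * N x) \<partial>M) = char std_normal_distribution \<sigma>"
      unfolding char_def lawN[symmetric] by (subst integral_distr) auto
    also have "\<dots> = complex_of_real (exp (- (\<sigma>\<^sup>2) / 2))"
      by (simp add: char_std_normal_distribution)
    also have "iexp m * \<dots> = exp (\<i> * complex_of_real m - complex_of_real (\<sigma>\<^sup>2 / 2))"
      by (simp only: exp_of_real[symmetric] exp_add[symmetric]) simp
    finally show ?thesis
      using sq normal_distributed_expectation[OF pos D] normal_distributed_variance[OF pos D] by simp
  qed
  then show "sq_integrable M X" "(\<integral>x. iexp (X x) \<partial>M) = exp (\<i> * complex_of_real (\<integral>x. X x \<partial>M) - complex_of_real (variance X / 2))"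
    by auto
qed

lemma (in prob_space) gaussian_vector_sq_integrable:
  fixes X :: "'a \<Rightarrow> 'b::euclidean_space"
  assumes "gaussian_vector M X"
  shows "sq_integrable M (\<lambda>x. u \<bullet> X x)"
proof -
  have [measurable]: "X \<in> borel_measurable M"
    using assms by (simp add: gaussian_vector_def)
  obtain m \<sigma> where "0 \<le> \<sigma>" "distr M borel (\<lambda>x. u \<bullet> X x) = gaussian_law m \<sigma>"
    using assms unfolding gaussian_vector_def by blast
  then show ?thesis by (intro gaussian_law_char(1)[of _ m \<sigma>]) measurable
qed

text \<open>The shift \<open>c\<close> is allowed because projections of the regression residual
  carry a constant coming from the mean of \<open>Y\<close>. It multiplies the transform by
  \<open>iexp c\<close>, moves the mean by \<open>c\<close> and leaves the variance alone.\<close>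

lemma (in prob_space) gaussian_vector_char:
  fixes X :: "'a \<Rightarrow> 'b::euclidean_space"
  assumes X: "gaussian_vector M X" and V: "\<And>x. V x = u \<bullet> X x + c"
  shows "(\<integral>x. iexp (V x) \<partial>M) = exp (\<i> * complex_of_real (\<integral>x. V x \<partial>M) - complex_of_real (variance V / 2))"
proof -
  have [measurable]: "(\<lambda>x. u \<bullet> X x) \<in> borel_measurable M"
    using X unfolding gaussian_vector_def by auto
  obtain m \<sigma> where "0 \<le> \<sigma>" "distr M borel (\<lambda>x. u \<bullet> X x) = gaussian_law m \<sigma>"
    using X unfolding gaussian_vector_def by blast
  from gaussian_law_char(2)[OF _ this(2,1)]
  have *: "(\<integral>x. iexp (u \<bullet> X x) \<partial>M) = exp (\<i> * complex_of_real (\<integral>x. u \<bullet> X x \<partial>M) - complex_of_real (variance (\<lambda>x. u \<bullet> X x) / 2))"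
    by simp
  have "integrable M (\<lambda>x. u \<bullet> X x)"
    using gaussian_vector_sq_integrable[OF X] by (rule sq_integrable_integrable)
  then have EV: "(\<integral>x. V x \<partial>M) = (\<integral>x. u \<bullet> X x \<partial>M) + c"
    by (simp add: V prob_space del: integral_inner_right)
  have "variance V = variance (\<lambda>x. u \<bullet> X x)"
    by (simp add: EV V del: integral_inner_right)
  moreover have "(\<integral>x. iexp (V x) \<partial>M) = (\<integral>x. iexp (u \<bullet> X x) * iexp c \<partial>M)"
    by (simp add: V distrib_left exp_add)
  then have "(\<integral>x. iexp (V x) \<partial>M) = (\<integral>x. iexp (u \<bullet> X x) \<partial>M) * iexp c"
    by simp
  ultimately show ?thesis
    unfolding * EV by (simp add: algebra_simps flip: exp_add)
qed

subsection \<open>The regression residual\<close>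

lemma
  assumes "invertible A"
  shows matrix_inv_right: "A ** matrix_inv A = mat 1"
    and matrix_inv_left: "matrix_inv A ** A = mat 1"
proof -
  from assms have "\<exists>A'. A ** A' = mat 1 \<and> A' ** A = mat 1"
    by (simp add: invertible_def)
  then have "A ** matrix_inv A = mat 1 \<and> matrix_inv A ** A = mat 1"
    unfolding matrix_inv_def by (rule someI_ex)
  then show "A ** matrix_inv A = mat 1" "matrix_inv A ** A = mat 1" by auto
qed

locale gaussian_pair = prob_space M for M :: "'a measure" +
  fixes S :: "'a \<Rightarrow> real ^ 's" and Y :: "'a \<Rightarrow> real ^ 'y"
  assumes gaussian: "gaussian_vector M (\<lambda>\<omega>. (S \<omega>, Y \<omega>))"
    and invertible: "invertible (covariance_matrix M Y)"
begin

text \<open>The regression matrix, called \<open>K\<close> in the overview.\<close>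

definition gain :: "real ^ 'y ^ 's" where
  "gain = cross_covariance M S Y ** matrix_inv (covariance_matrix M Y)"

definition centered :: "'a \<Rightarrow> real ^ 'y" where
  "centered \<omega> = Y \<omega> - (\<integral>\<omega>'. Y \<omega>' \<partial>M)"

definition residual :: "'a \<Rightarrow> real ^ 's" where
  "residual \<omega> = S \<omega> - gain *v centered \<omega>"

section \<open>Second moments and the normal equations\<close>

lemma sq_integrable_S: "sq_integrable M S"
  using gaussian_vector_sq_integrable[OF gaussian, of "(axis i 1, 0)" for i]
  by (subst sq_integrable_vec_iff) (simp add: inner_axis')

lemma sq_integrable_Y: "sq_integrable M Y"
  using gaussian_vector_sq_integrable[OF gaussian, of "(0, axis i 1)" for i]
  by (subst sq_integrable_vec_iff) (simp add: inner_axis')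

lemma sq_integrable_centered: "sq_integrable M centered"
  unfolding centered_def[abs_def] by (intro sq_integrable_diff sq_integrable_Y sq_integrable_const)

lemma sq_integrable_residual: "sq_integrable M residual"
  unfolding residual_def[abs_def]
  by (intro sq_integrable_diff sq_integrable_S sq_integrable_matrix sq_integrable_centered)

text \<open>Reconciles the coordinatewise means in \<open>cross_covariance\<close> with the vector
  mean in \<open>centered\<close>.\<close>

lemma integral_Y_nth: "(\<integral>\<omega>. Y \<omega> $ j \<partial>M) = (\<integral>\<omega>. Y \<omega> \<partial>M) $ j"
  by (rule integral_bounded_linear[OF bounded_linear_vec_nth]) (rule sq_integrable_integrable[OF sq_integrable_Y])

lemma integral_centered: "(\<integral>\<omega>. centered \<omega> $ j \<partial>M) = 0"
proof -
  have "integrable M (\<lambda>\<omega>. Y \<omega> $ j)"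
    by (intro sq_integrable_integrable sq_integrable_vec_nth sq_integrable_Y)
  then show ?thesis by (simp add: centered_def prob_space integral_Y_nth)
qed

text \<open>Centring one factor suffices: the mean of \<open>V\<close> is multiplied by
  \<open>centered\<close>, which integrates to zero.\<close>

lemma cross_covariance_centered:
  fixes V :: "'a \<Rightarrow> real ^ 'n"
  assumes V: "sq_integrable M V"
  shows "cross_covariance M V Y $ i $ j = (\<integral>\<omega>. centered \<omega> $ j * V \<omega> $ i \<partial>M)"
proof -
  have int: "integrable M (\<lambda>\<omega>. centered \<omega> $ j * V \<omega> $ i)" "integrable M (\<lambda>\<omega>. centered \<omega> $ j)"
    by (intro sq_integrable_mult sq_integrable_integrable sq_integrable_vec_nth sq_integrable_centered V)+
  have "cross_covariance M V Y $ i $ j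
      = (\<integral>\<omega>. centered \<omega> $ j * V \<omega> $ i - (\<integral>\<omega>'. V \<omega>' $ i \<partial>M) * centered \<omega> $ j \<partial>M)"
    by (simp add: cross_covariance_def integral_Y_nth centered_def algebra_simps)
  then show ?thesis
    using int by (simp add: integral_centered)
qed

lemma covariance_centered:
  "covariance_matrix M Y $ i $ j = (\<integral>\<omega>. centered \<omega> $ j * centered \<omega> $ i \<partial>M)"
proof -
  have "integrable M (\<lambda>\<omega>. centered \<omega> $ j * Y \<omega> $ i)" "integrable M (\<lambda>\<omega>. centered \<omega> $ j)"
    by (intro sq_integrable_mult sq_integrable_integrable sq_integrable_vec_nth sq_integrable_centered sq_integrable_Y)+
  moreover have "centered \<omega> $ j * centered \<omega> $ i = centered \<omega> $ j * Y \<omega> $ i - (\<integral>\<omega>. Y \<omega> \<partial>M) $ i * centered \<omega> $ j" for \<omega>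
    by (simp add: centered_def algebra_simps)
  ultimately show ?thesis
    by (simp add: cross_covariance_centered[OF sq_integrable_Y] integral_centered)
qed

text \<open>Used in two ways: with the matrix \<open>gain\<close> it gives the normal equations, and
  with \<open>gain - B\<close> it recovers the slope of an optimal regression.\<close>

lemma integral_matrix_centered:
  fixes B :: "real ^ 'y ^ 'n"
  shows "(\<integral>\<omega>. centered \<omega> $ j * (B *v centered \<omega>) $ i \<partial>M) = (B ** covariance_matrix M Y) $ i $ j"
proof -
  have int: "integrable M (\<lambda>\<omega>. centered \<omega> $ j * centered \<omega> $ k)" for k
    by (intro sq_integrable_mult sq_integrable_vec_nth sq_integrable_centered)
  have "centered \<omega> $ j * (B *v centered \<omega>) $ i = (\<Sum>k\<in>UNIV. B $ i $ k * (centered \<omega> $ j * centered \<omega> $ k))" for \<omega>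
    by (simp add: matrix_vector_mult_def sum_distrib_left mult_ac)
  then show ?thesis
    using int by (simp add: matrix_matrix_mult_def covariance_centered)
qed

text \<open>These are the normal equations: \<open>gain\<close> is chosen so that its product with
  the covariance matrix of \<open>Y\<close> is the cross-covariance.\<close>

lemma uncorrelated_residual: "uncorrelated M centered residual"
  unfolding uncorrelated_def
proof (intro allI)
  fix i j
  have "integrable M (\<lambda>\<omega>. centered \<omega> $ j * S \<omega> $ i)" "integrable M (\<lambda>\<omega>. centered \<omega> $ j * (gain *v centered \<omega>) $ i)"
    by (intro sq_integrable_mult sq_integrable_vec_nth sq_integrable_matrix sq_integrable_centered sq_integrable_S)+
  then have "(\<integral>\<omega>. centered \<omega> $ j * residual \<omega> $ i \<partial>M)
      = cross_covariance M S Y $ i $ j - (gain ** covariance_matrix M Y) $ i $ j"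
    by (simp add: residual_def right_diff_distrib cross_covariance_centered[OF sq_integrable_S] integral_matrix_centered)
  also have "gain ** covariance_matrix M Y = cross_covariance M S Y"
    by (simp add: gain_def matrix_mul_assoc[symmetric] matrix_inv_left[OF invertible])
  finally show "(\<integral>\<omega>. centered \<omega> $ j * residual \<omega> $ i \<partial>M) = 0" by simp
qed

lemma measurable_SY [measurable]: "S \<in> borel_measurable M" "Y \<in> borel_measurable M"
  "residual \<in> borel_measurable M" "centered \<in> borel_measurable M"
  using sq_integrable_S sq_integrable_Y sq_integrable_residual sq_integrable_centered
  by (auto simp: sq_integrable_def)

section \<open>Independence of the residual and \<open>Y\<close>\<close>

lemma covariance_residual_Y:
  "(\<integral>\<omega>. (v \<bullet> centered \<omega>) * (u \<bullet> residual \<omega>) \<partial>M) = 0"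
proof -
  \<comment> \<open>The rank-one matrix of \<open>u\<close> and \<open>v\<close> sends
    \<open>centered\<close> to a multiple of \<open>u\<close>, so the matrix form of
    uncorrelatedness yields the product of two scalar projections.\<close>
  have "((\<chi> i j. u $ i * v $ j) *v centered \<omega>) \<bullet> residual \<omega> = (v \<bullet> centered \<omega>) * (u \<bullet> residual \<omega>)" for \<omega>
  proof -
    have "(\<chi> i j. u $ i * v $ j) *v centered \<omega> = (v \<bullet> centered \<omega>) *\<^sub>R u"
      by (simp add: vec_eq_iff matrix_vector_mult_def inner_vec_def sum_distrib_left mult_ac)
    then show ?thesis by simp
  qed
  then show ?thesis
    using uncorrelated_matrix[OF sq_integrable_centered sq_integrable_residual uncorrelated_residual,
        of "\<chi> i j. u $ i * v $ j"] by simp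
qed

text \<open>Every combination of \<open>residual\<close> and \<open>Y\<close> is an affine function
  of the Gaussian pair, so its transform depends only on mean and variance. Means add, variances add
  because the covariance vanishes, and the exponential factorizes.\<close>

lemma indep_residual: "indep_rv M residual Y"
proof (rule indep_rv_if_char_factorizes)
  fix u :: "real ^ 's" and v :: "real ^ 'y"
  define A where "A \<omega> = u \<bullet> residual \<omega>" for \<omega>
  define B where "B \<omega> = v \<bullet> Y \<omega>" for \<omega>
  \<comment> \<open>The transpose of \<open>gain\<close> applied to \<open>u\<close>. It moves
    \<open>gain\<close> across the inner product and exhibits \<open>u \<bullet> residual\<close> as
    the functional \<open>(u, - k)\<close> of \<open>(S, Y)\<close> plus a constant.\<close>
  define k where "k = u v* gain"
  have uR: "u \<bullet> residual \<omega> = (u, - k) \<bullet> (S \<omega>, Y \<omega>) + k \<bullet> (\<integral>\<omega>. Y \<omega> \<partial>M)" for \<omega>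
  proof -
    have "u \<bullet> (gain *v w) = k \<bullet> w" for w
      by (simp add: k_def dot_lmul_matrix)
    then show ?thesis
      by (simp add: residual_def centered_def inner_diff_right)
  qed
  have sq: "sq_integrable M A" "sq_integrable M B" "sq_integrable M (\<lambda>\<omega>. v \<bullet> centered \<omega>)"
    unfolding A_def[abs_def] B_def[abs_def]
    by (intro sq_integrable_linear[OF _ bounded_linear_inner_right] sq_integrable_residual sq_integrable_Y sq_integrable_centered)+
  then have int: "integrable M A" "integrable M B"
    by (auto intro: sq_integrable_integrable)
  define a where "a = (\<integral>\<omega>. A \<omega> \<partial>M)"
  define b where "b = (\<integral>\<omega>. B \<omega> \<partial>M)"
  have b: "b = v \<bullet> (\<integral>\<omega>. Y \<omega> \<partial>M)"
    unfolding b_def B_def using sq_integrable_integrable[OF sq_integrable_Y] by simp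
  have Bb: "B \<omega> - b = v \<bullet> centered \<omega>" for \<omega>
    by (simp add: B_def b centered_def inner_diff_right)
  have EAB: "(\<integral>\<omega>. A \<omega> + B \<omega> \<partial>M) = a + b"
    using int by (simp add: a_def b_def)
  have mean: "(\<integral>\<omega>. v \<bullet> centered \<omega> \<partial>M) = 0"
    using int(2) unfolding Bb[symmetric] by (simp add: prob_space b_def)
  have cov: "(\<integral>\<omega>. (A \<omega> - a) * (B \<omega> - b) \<partial>M) = 0"
  proof -
    have "(\<integral>\<omega>. (A \<omega> - a) * (B \<omega> - b) \<partial>M)
        = (\<integral>\<omega>. (v \<bullet> centered \<omega>) * (u \<bullet> residual \<omega>) - a * (v \<bullet> centered \<omega>) \<partial>M)"
      by (simp add: Bb A_def algebra_simps)
    also have "\<dots> = (\<integral>\<omega>. (v \<bullet> centered \<omega>) * (u \<bullet> residual \<omega>) \<partial>M) - (\<integral>\<omega>. a * (v \<bullet> centered \<omega>) \<partial>M)"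
      using sq_integrable_mult[OF sq(3,1)] sq_integrable_integrable[OF sq(3)]
      by (intro Bochner_Integration.integral_diff integrable_mult_right) (simp_all add: A_def)
    also have "\<dots> = 0"
      by (simp add: covariance_residual_Y mean del: integral_inner_right)
    finally show ?thesis .
  qed
  have sq': "sq_integrable M (\<lambda>\<omega>. A \<omega> - a)" "sq_integrable M (\<lambda>\<omega>. B \<omega> - b)"
    by (intro sq_integrable_diff sq sq_integrable_const)+
  \<comment> \<open>Variances are written as integrals of squared norms so that Pythagoras applies
    to the centred summands.\<close>
  have "variance (\<lambda>\<omega>. A \<omega> + B \<omega>) = (\<integral>\<omega>. (norm ((A \<omega> - a) + (B \<omega> - b)))\<^sup>2 \<partial>M)"
    by (simp add: EAB algebra_simps)
  also have "\<dots> = variance A + variance B"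
    by (subst integral_norm_squared_orthogonal[OF sq']) (simp_all add: cov[unfolded a_def b_def] a_def b_def)
  finally have var: "variance (\<lambda>\<omega>. A \<omega> + B \<omega>) = variance A + variance B" .
  have "(\<integral>\<omega>. iexp (A \<omega> + B \<omega>) \<partial>M) = exp (\<i> * complex_of_real (a + b) - complex_of_real ((variance A + variance B) / 2))"
    unfolding var[symmetric] EAB[symmetric]
    by (rule gaussian_vector_char[OF gaussian, of _ "(u, v - k)" "k \<bullet> (\<integral>\<omega>. Y \<omega> \<partial>M)"])
       (simp add: A_def B_def uR inner_diff_left)
  also have "\<dots> = exp (\<i> * complex_of_real a - complex_of_real (variance A / 2))
      * exp (\<i> * complex_of_real b - complex_of_real (variance B / 2))"
    by (simp add: algebra_simps add_divide_distrib flip: exp_add)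
  also have "exp (\<i> * complex_of_real a - complex_of_real (variance A / 2)) = (\<integral>\<omega>. iexp (A \<omega>) \<partial>M)"
    unfolding a_def
    by (rule gaussian_vector_char[OF gaussian, of _ "(u, - k)" "k \<bullet> (\<integral>\<omega>. Y \<omega> \<partial>M)", symmetric])
       (simp add: A_def uR)
  also have "exp (\<i> * complex_of_real b - complex_of_real (variance B / 2)) = (\<integral>\<omega>. iexp (B \<omega>) \<partial>M)"
    unfolding b_def
    by (rule gaussian_vector_char[OF gaussian, of _ "(0, v)" 0, symmetric]) (simp add: B_def)
  finally show "(\<integral>\<omega>. iexp (u \<bullet> residual \<omega> + v \<bullet> Y \<omega>) \<partial>M)
      = (\<integral>\<omega>. iexp (u \<bullet> residual \<omega>) \<partial>M) * (\<integral>\<omega>. iexp (v \<bullet> Y \<omega>) \<partial>M)"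
    by (simp only: A_def B_def)
qed measurable

section \<open>Optimality of the residual among admissible vectors\<close>

lemma uncorrelated_indep:
  fixes U :: "'a \<Rightarrow> real ^ 'n"
  assumes U: "sq_integrable M U" and ind: "indep_rv M U Y"
  shows "uncorrelated M centered U"
  unfolding uncorrelated_def
proof (intro allI)
  fix i j
  have int: "integrable M (\<lambda>\<omega>. U \<omega> $ i)" "integrable M (\<lambda>\<omega>. Y \<omega> $ j)" "integrable M (\<lambda>\<omega>. U \<omega> $ i * Y \<omega> $ j)"
    by (intro sq_integrable_mult sq_integrable_integrable sq_integrable_vec_nth sq_integrable_Y U)+
  \<comment> \<open>After expanding \<open>centered\<close>, independence turns the mixed moment
    into the product of the means, which the second term cancels.\<close>
  have "(\<integral>\<omega>. centered \<omega> $ j * U \<omega> $ i \<partial>M) = (\<integral>\<omega>. U \<omega> $ i * Y \<omega> $ j - (\<integral>\<omega>. Y \<omega> \<partial>M) $ j * U \<omega> $ i \<partial>M)"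
    by (simp add: centered_def algebra_simps)
  also have "\<dots> = 0"
    using int by (simp add: indep_rv_integral_mult[OF ind] integral_Y_nth)
  finally show "(\<integral>\<omega>. centered \<omega> $ j * U \<omega> $ i \<partial>M) = 0" .
qed

text \<open>Common to both minimization problems. The pair \<open>B\<close>, \<open>V\<close> is
  instantiated by \<open>gain\<close> and 0 for the residual, by \<open>gain\<close> and
  \<open>residual - U\<close> for an admissible \<open>U\<close>, and by a slope error and a shifted
  residual for a regression.\<close>

lemma cost_decomposition:
  assumes V: "sq_integrable M V" and un: "uncorrelated M centered V"
    and eq: "\<And>\<omega>. S \<omega> - U \<omega> = B *v centered \<omega> + V \<omega>"
  shows "quadratic_cost M S U
    = ennreal ((\<integral>\<omega>. (norm (B *v centered \<omega>))\<^sup>2 \<partial>M) + (\<integral>\<omega>. (norm (V \<omega>))\<^sup>2 \<partial>M))"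
proof -
  have B: "sq_integrable M (\<lambda>\<omega>. B *v centered \<omega>)"
    by (intro sq_integrable_matrix sq_integrable_centered)
  have "sq_integrable M (\<lambda>\<omega>. S \<omega> - U \<omega>)"
    unfolding eq by (intro sq_integrable_add B V)
  then have "quadratic_cost M S U = ennreal (\<integral>\<omega>. (norm (S \<omega> - U \<omega>))\<^sup>2 \<partial>M)"
    by (rule quadratic_cost_eq)
  also have "(\<integral>\<omega>. (norm (S \<omega> - U \<omega>))\<^sup>2 \<partial>M)
      = (\<integral>\<omega>. (norm (B *v centered \<omega>))\<^sup>2 \<partial>M) + (\<integral>\<omega>. (norm (V \<omega>))\<^sup>2 \<partial>M)"
    unfolding eq
    by (rule integral_norm_squared_orthogonal[OF B V])
       (rule uncorrelated_matrix[OF sq_integrable_centered V un])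
  finally show ?thesis .
qed

lemma cost_residual:
  "quadratic_cost M S residual = ennreal (\<integral>\<omega>. (norm (gain *v centered \<omega>))\<^sup>2 \<partial>M)"
  using cost_decomposition[of "\<lambda>_. 0" residual gain]
  by (simp add: sq_integrable_const uncorrelated_def residual_def)

text \<open>Finite cost makes \<open>S - U\<close> square-integrable, hence also \<open>U\<close>.
  Independence then makes \<open>U\<close> uncorrelated with \<open>centered\<close>, as
  \<open>residual\<close> is, and so is their difference.\<close>

lemma cost_admissible:
  assumes adm: "barycenter_admissible M S Y U" and fin: "quadratic_cost M S U < \<infinity>"
  shows "sq_integrable M (\<lambda>\<omega>. residual \<omega> - U \<omega>)"
    and "quadratic_cost M S U = ennreal ((\<integral>\<omega>. (norm (gain *v centered \<omega>))\<^sup>2 \<partial>M)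
            + (\<integral>\<omega>. (norm (residual \<omega> - U \<omega>))\<^sup>2 \<partial>M))"
proof -
  have ind: "indep_rv M U Y" using adm by (simp add: barycenter_admissible_def)
  then have [measurable]: "U \<in> borel_measurable M" by (simp add: indep_rv_def)
  have "sq_integrable M (\<lambda>\<omega>. S \<omega> - U \<omega>)"
    using fin by (intro quadratic_cost_finite) auto
  from sq_integrable_diff[OF sq_integrable_S this] have U: "sq_integrable M U" by simp
  show V: "sq_integrable M (\<lambda>\<omega>. residual \<omega> - U \<omega>)"
    by (intro sq_integrable_diff sq_integrable_residual U)
  show "quadratic_cost M S U = ennreal ((\<integral>\<omega>. (norm (gain *v centered \<omega>))\<^sup>2 \<partial>M)
            + (\<integral>\<omega>. (norm (residual \<omega> - U \<omega>))\<^sup>2 \<partial>M))"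
  proof (rule cost_decomposition[OF V])
    show "uncorrelated M centered (\<lambda>\<omega>. residual \<omega> - U \<omega>)"
      by (intro uncorrelated_diff sq_integrable_centered sq_integrable_residual U
          uncorrelated_residual uncorrelated_indep ind)
  qed (simp add: residual_def)
qed

lemma residual_admissible: "barycenter_admissible M S Y residual"
  unfolding barycenter_admissible_def
proof (intro conjI bexI ballI indep_residual)
  \<comment> \<open>The transport map is affine in the pair, hence continuous and Borel.\<close>
  let ?T = "\<lambda>p. fst p - gain *v (snd p - (\<integral>\<omega>. Y \<omega> \<partial>M))"
  show "residual \<omega> = ?T (S \<omega>, Y \<omega>)" for \<omega>
    by (simp add: residual_def centered_def)
  show "?T \<in> borel_measurable borel"
    by (intro borel_measurable_continuous_onI continuous_intros
        linear_continuous_on_compose[OF _ matrix_vector_mul_linear])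
qed

text \<open>A strictly better competitor would have finite cost, so the decomposition applies to it
  and shows its cost to be at least that of \<open>residual\<close>.\<close>

lemma barycenter_solution_residual: "barycenter_solution M S Y residual"
  unfolding barycenter_solution_def is_arg_min_def
proof (intro conjI residual_admissible notI, elim exE conjE)
  fix U assume adm: "barycenter_admissible M S Y U"
    and less: "quadratic_cost M S U < quadratic_cost M S residual"
  then have "quadratic_cost M S U < \<infinity>"
    by (auto intro: less_le_trans)
  from cost_admissible(2)[OF adm this] have "quadratic_cost M S residual \<le> quadratic_cost M S U"
    unfolding cost_residual by (auto intro!: ennreal_leI)
  with less show False by simp
qed

text \<open>Comparison with the admissible \<open>residual\<close> forces the excess term in the
  cost of \<open>U\<close> to vanish.\<close>

lemma barycenter_solution_unique:
  assumes "barycenter_solution M S Y U"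
  shows "AE \<omega> in M. U \<omega> = residual \<omega>"
proof -
  have adm: "barycenter_admissible M S Y U"
    and le: "quadratic_cost M S U \<le> quadratic_cost M S residual"
    using assms residual_admissible by (auto simp: barycenter_solution_def is_arg_min_def not_less)
  have "quadratic_cost M S U < \<infinity>"
    by (rule le_less_trans[OF le]) (simp add: cost_residual)
  note V = cost_admissible[OF adm this]
  have "(\<integral>\<omega>. (norm (residual \<omega> - U \<omega>))\<^sup>2 \<partial>M) \<le> 0"
    using le unfolding V(2) cost_residual by (subst (asm) ennreal_le_iff) auto
  from integral_norm_squared_eq_0[OF V(1) this] show ?thesis
    by eventually_elim simp
qed

section \<open>Linear regression of \<open>S\<close> on \<open>Y\<close>\<close>

definition mean_residual :: "real ^ 's" where
  "mean_residual = (\<integral>\<omega>. residual \<omega> \<partial>M)"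

text \<open>The trace of the covariance matrix of the residual; it turns out to be the minimal
  regression cost.\<close>

definition variance_residual :: real where
  "variance_residual = (\<integral>\<omega>. (norm (residual \<omega> - mean_residual))\<^sup>2 \<partial>M)"

text \<open>Here \<open>c\<close> is the predicted value at the mean of \<open>Y\<close>, so the
  prediction is \<open>c + B *v centered\<close>. Pythagoras first separates the slope error and
  then, the centred residual being orthogonal to constants, the intercept error.\<close>

lemma cost_regression:
  fixes a B
  defines "c \<equiv> a + B *v (\<integral>\<omega>. Y \<omega> \<partial>M)"
  shows "quadratic_cost M S (\<lambda>\<omega>. a + B *v Y \<omega>)
    = ennreal ((\<integral>\<omega>. (norm ((gain - B) *v centered \<omega>))\<^sup>2 \<partial>M)
        + (variance_residual + (norm (mean_residual - c))\<^sup>2))"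
proof -
  have R: "sq_integrable M (\<lambda>\<omega>. residual \<omega> - d)" for d
    by (intro sq_integrable_diff sq_integrable_const sq_integrable_residual)
  have "quadratic_cost M S (\<lambda>\<omega>. a + B *v Y \<omega>)
    = ennreal ((\<integral>\<omega>. (norm ((gain - B) *v centered \<omega>))\<^sup>2 \<partial>M) + (\<integral>\<omega>. (norm (residual \<omega> - c))\<^sup>2 \<partial>M))"
  proof (rule cost_decomposition[OF R])
    show "uncorrelated M centered (\<lambda>\<omega>. residual \<omega> - c)"
      by (intro uncorrelated_diff sq_integrable_centered sq_integrable_residual sq_integrable_const
          uncorrelated_residual uncorrelated_const integral_centered)
    show "S \<omega> - (a + B *v Y \<omega>) = (gain - B) *v centered \<omega> + (residual \<omega> - c)" for \<omega>
      by (simp add: residual_def centered_def c_def matrix_vector_mult_diff_rdistrib matrix_vector_mult_diff_distrib)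
  qed
  also have "(\<integral>\<omega>. (norm (residual \<omega> - c))\<^sup>2 \<partial>M)
      = (\<integral>\<omega>. (norm ((residual \<omega> - mean_residual) + (mean_residual - c)))\<^sup>2 \<partial>M)"
    by simp
  also have "\<dots> = variance_residual + (\<integral>\<omega>. (norm (mean_residual - c))\<^sup>2 \<partial>M)"
    unfolding variance_residual_def
  proof (rule integral_norm_squared_orthogonal[OF R sq_integrable_const])
    have "integrable M residual" by (rule sq_integrable_integrable[OF sq_integrable_residual])
    then have "(\<integral>\<omega>. residual \<omega> - mean_residual \<partial>M) = 0"
      by (simp add: mean_residual_def prob_space)
    then show "(\<integral>\<omega>. (residual \<omega> - mean_residual) \<bullet> (mean_residual - c) \<partial>M) = 0"
      using sq_integrable_integrable[OF R] by (subst integral_inner_left) auto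
  qed
  finally show ?thesis by (simp add: prob_space)
qed

text \<open>This intercept makes \<open>c\<close> equal to \<open>mean_residual\<close>, so slope
  and intercept error both vanish.\<close>

lemma cost_regression_gain:
  "quadratic_cost M S (\<lambda>\<omega>. mean_residual - gain *v (\<integral>\<omega>. Y \<omega> \<partial>M) + gain *v Y \<omega>) = ennreal variance_residual"
  by (simp add: cost_regression)

lemma variance_residual_nonneg: "0 \<le> variance_residual"
  by (simp add: variance_residual_def)

lemma linear_regression_exists:
  "linear_regression M S Y (mean_residual - gain *v (\<integral>\<omega>. Y \<omega> \<partial>M)) gain"
  unfolding linear_regression_def is_arg_min_def split_paired_Ex
  by (auto simp: cost_regression_gain not_less, simp add: cost_regression)
     (auto intro!: ennreal_leI)

text \<open>Optimality makes \<open>(gain - B) *v centered\<close> vanish almost everywhere.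
  Integrating it against the coordinates of \<open>centered\<close> gives that
  \<open>gain - B\<close> times the covariance matrix is 0, and the invertible factor
  cancels.\<close>

lemma linear_regression_gain:
  assumes "linear_regression M S Y a B"
  shows "B = gain"
proof -
  have "quadratic_cost M S (\<lambda>\<omega>. a + B *v Y \<omega>) \<le> ennreal variance_residual"
    using assms unfolding linear_regression_def is_arg_min_def
    by (auto simp: not_less cost_regression_gain[symmetric])
  then have "(\<integral>\<omega>. (norm ((gain - B) *v centered \<omega>))\<^sup>2 \<partial>M)
      + (norm (mean_residual - (a + B *v (\<integral>\<omega>. Y \<omega> \<partial>M))))\<^sup>2 \<le> 0"
    unfolding cost_regression by (subst (asm) ennreal_le_iff) (auto simp: variance_residual_nonneg)
  then have "(\<integral>\<omega>. (norm ((gain - B) *v centered \<omega>))\<^sup>2 \<partial>M) \<le> 0"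
    by (smt (verit) zero_le_power2)
  then have ae: "AE \<omega> in M. (gain - B) *v centered \<omega> = 0"
    by (intro integral_norm_squared_eq_0 sq_integrable_matrix sq_integrable_centered)
  have "((gain - B) ** covariance_matrix M Y) $ i $ j = 0" for i j
    unfolding integral_matrix_centered[symmetric]
  proof (rule integral_eq_zero_AE)
    show "AE \<omega> in M. centered \<omega> $ j * ((gain - B) *v centered \<omega>) $ i = 0"
      using ae by eventually_elim simp
  qed
  then have "(gain - B) ** covariance_matrix M Y = 0"
    by (simp add: vec_eq_iff)
  then have "(gain - B) ** covariance_matrix M Y ** matrix_inv (covariance_matrix M Y) = 0"
    by (simp add: matrix_matrix_mult_def vec_eq_iff)
  then have "gain - B = 0"
    by (simp add: matrix_mul_assoc[symmetric] matrix_inv_right[OF invertible])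
  then show ?thesis by simp
qed

end

theorem lemma6:
  fixes M :: "'a measure"
    and S :: "'a \<Rightarrow> real ^ 's"
    and Y :: "'a \<Rightarrow> real ^ 'y"
  assumes "prob_space M"
    and "gaussian_vector M (\<lambda>\<omega>. (S \<omega>, Y \<omega>))"
    and "invertible (covariance_matrix M Y)"
  shows "let S\<^sub>Y = (\<lambda>\<omega>. S \<omega> -
               (cross_covariance M S Y ** matrix_inv (covariance_matrix M Y)) *v
                 (Y \<omega> - (\<integral>\<omega>'. Y \<omega>' \<partial>M)))
         in barycenter_solution M S Y S\<^sub>Y \<and>
            (\<forall>U. barycenter_solution M S Y U \<longrightarrow> (AE \<omega> in M. U \<omega> = S\<^sub>Y \<omega>)) \<and>
            (\<exists>a B. linear_regression M S Y a B) \<and>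
            (\<forall>a B. linear_regression M S Y a B \<longrightarrow>
               (\<exists>c. \<forall>\<omega>\<in>space M. S\<^sub>Y \<omega> = (S \<omega> - (a + B *v Y \<omega>)) + c))"
proof -
  interpret P: prob_space M by fact
  interpret gaussian_pair M S Y
    by unfold_locales (use assms in auto)
  have S\<^sub>Y: "(\<lambda>\<omega>. S \<omega> - (cross_covariance M S Y ** matrix_inv (covariance_matrix M Y)) *v
      (Y \<omega> - (\<integral>\<omega>'. Y \<omega>' \<partial>M))) = residual"
    by (simp add: residual_def[abs_def] gain_def centered_def)
  have "\<exists>c. \<forall>\<omega>\<in>space M. residual \<omega> = (S \<omega> - (a + B *v Y \<omega>)) + c"
    if "linear_regression M S Y a B" for a B
    using linear_regression_gain[OF that]
    \<comment> \<open>The constant removes the regression intercept \<open>a\<close> and restores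
      the contribution of the mean of \<open>Y\<close>.\<close>
    by (intro exI[of _ "a + gain *v (\<integral>\<omega>. Y \<omega> \<partial>M)"])
       (simp add: residual_def centered_def matrix_vector_mult_diff_distrib)
  then show ?thesis
    unfolding S\<^sub>Y Let_def
    using barycenter_solution_residual barycenter_solution_unique linear_regression_exists by blast
qed

end
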